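(* Let $L\in\mathbb{N}$ and let $p_{n,0,0}$ be the number of forward pyramid walks of length $n$ in $\mathcal{S}_{3,L}$ starting at the corner $Le_4$. Then the generating function $P(t)=\sum_{n=0}^{\infty}p_{n,0,0}t^n$ is given by $$P(t)=\frac{1}{(L+4)^2}\sum_{\substack{1\le j<k\le L+3\\ j,k\text{ odd}}}\frac{(\alpha^{k}+\alpha^{-k}-\alpha^{j}-\alpha^{-j})^2(2+\alpha^{j}+\alpha^{-j})(2+\alpha^{k}+\alpha^{-k})}{1-(\alpha^{j}+\alpha^{-j}+\alpha^{k}+\alpha^{-k})t},$$ where $\alpha=e^{\frac{i\pi}{L+4}}$ (here $i$ is the imaginary unit).
   Context: $\mathbb{N}=\{0,1,2,\dots\}$ and $(e_1,e_2,e_3,e_4)$ is the standard basis of $\mathbb{R}^4$. $\mathcal{S}_{3,L}=\{x_1e_1+x_2e_2+x_3e_3+x_4e_4 : x_1,x_2,x_3,x_4\in\mathbb{N},\ x_1+x_2+x_3+x_4=L\}$. Forward steps: $e_1-e_4,\ e_2-e_1,\ e_3-e_2,\ e_4-e_3$. A forward pyramid walk of length $n$ starting at $z\in\mathcal{S}_{3,L}$ is a sequence of $n$ forward steps such that all successive positions, starting from $z$, lie in $\mathcal{S}_{3,L}$. The identity is between formal power series in $t$ (over $\mathbb{C}$). *)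

theory Defs
  imports "HOL-Analysis.Analysis" "HOL-Computational_Algebra.Formal_Power_Series"
begin

(* In the index type 4 the numeral 4 denotes the same element as 0, so the four
   coordinates of real^4 are those with indices 1, 2, 3, 4. *)
abbreviation std_basis :: "4 \<Rightarrow> real^4" where
  "std_basis i \<equiv> axis i 1"

definition pyramid :: "nat \<Rightarrow> (real^4) set" where
  "pyramid L =
     {real x1 *\<^sub>R std_basis 1 + real x2 *\<^sub>R std_basis 2 +
      real x3 *\<^sub>R std_basis 3 + real x4 *\<^sub>R std_basis 4
      | x1 x2 x3 x4. x1 + x2 + x3 + x4 = L}"

definition forward_steps :: "(real^4) set" where
  "forward_steps =
     {std_basis 1 - std_basis 4, std_basis 2 - std_basis 1,
      std_basis 3 - std_basis 2, std_basis 4 - std_basis 3}"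

(* The positions include the starting point (m = 0) and the end point (m = length ss). *)
definition forward_walks :: "nat \<Rightarrow> real^4 \<Rightarrow> nat \<Rightarrow> (real^4) list set" where
  "forward_walks L z n =
     {ss. length ss = n \<and> set ss \<subseteq> forward_steps \<and>
          (\<forall>m\<le>n. z + sum_list (take m ss) \<in> pyramid L)}"

definition num_corner_walks :: "nat \<Rightarrow> nat \<Rightarrow> nat" where
  "num_corner_walks L n = card (forward_walks L (real L *\<^sub>R std_basis 4) n)"

definition walk_gf :: "nat \<Rightarrow> complex fps" where
  "walk_gf L = Abs_fps (\<lambda>n. of_nat (num_corner_walks L n))"

end

theory Submission
  imports Defs
begin

text \<open>
  Put \<open>N = L + 4\<close>. A point \<open>(x1, x2, x3, x4)\<close> of the pyramid corresponds to four particles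
  \<open>y1 < y2 < y3 < y4 < y1 + N\<close> on a ring of \<open>N\<close> sites, with successive gaps \<open>x3 + 1\<close>, \<open>x2 + 1\<close>,
  \<open>x1 + 1\<close>, \<open>x4 + 1\<close>; a forward step moves one particle one site ahead, and leaving the pyramid
  means a collision. Let \<open>S\<close> be the odd function that is 1 on \<open>0 < d < N\<close> and satisfies
  \<open>S (d + N) = - S d\<close>. The Pfaffian
  \<open>S (y2 - y1) S (y4 - y3) - S (y3 - y1) S (y4 - y2) + S (y4 - y1) S (y3 - y2)\<close> is 1 on the pyramid
  and vanishes at collisions. Expanding \<open>S\<close> into sines with odd frequencies \<open>j\<close> and \<open>k\<close> turns each
  term into an eigenfunction of the hopping operator with eigenvalue
  \<open>2 cos (j \<pi> / N) + 2 cos (k \<pi> / N)\<close>, and the sum of the terms for \<open>(j, k)\<close> and \<open>(k, j)\<close> vanishes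
  at collisions. Multiplying each term by the \<open>n\<close>-th power of its eigenvalue therefore counts the
  walks of length \<open>n\<close> from any starting point; at the corner all three gaps are 1.
\<close>

section \<open>Odd-frequency sine expansion of the square wave\<close>

definition angle :: "nat \<Rightarrow> nat \<Rightarrow> real" where
  "angle N j = real j * pi / real N"

definition eigval :: "nat \<Rightarrow> nat \<Rightarrow> real" where
  "eigval N j = 2 * cos (angle N j)"

definition wave :: "nat \<Rightarrow> nat \<Rightarrow> int \<Rightarrow> real" where
  "wave N j d = sin (of_int d * angle N j)"

text \<open>By the half-angle formula this is \<open>2 / N\<close> times the cotangent of half of
  \<open>angle N j\<close>: the Fourier coefficient of the square wave.\<close>

definition weight :: "nat \<Rightarrow> nat \<Rightarrow> real" where
  "weight N j = (2 + eigval N j) / (real N * sin (angle N j))"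

definition odds :: "nat \<Rightarrow> nat set" where
  "odds N = {j. odd j \<and> j < N}"

lemma finite_odds [simp]: "finite (odds N)"
  by (simp add: odds_def)

lemma odds_eq_image: "odds N = (\<lambda>m. 2 * m + 1) ` {..<N div 2}"
  by (auto simp: odds_def image_iff elim!: oddE)

lemma sum_odds: "(\<Sum>j\<in>odds N. f j) = (\<Sum>m<N div 2. f (2 * m + 1))"
  unfolding odds_eq_image by (subst sum.reindex) (auto simp: inj_on_def)

lemma sin_angle_pos:
  assumes "j \<in> odds N"
  shows "0 < sin (angle N j)"
proof (rule sin_gt_zero)
  have "0 < j" "j < N"
    using assms by (auto simp: odds_def intro: Nat.gr0I)
  then show "0 < angle N j" "angle N j < pi"
    by (simp_all add: angle_def field_simps)
qed

text \<open>The sum telescopes, since 2 sin x cos y = sin (y + x) - sin (y - x).\<close>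

lemma sum_cos_odd_multiples:
  fixes x :: real
  shows "2 * sin x * (\<Sum>m<M. cos (real (2 * m + 1) * x)) = sin (real (2 * M) * x)"
proof (induction M)
  case (Suc M)
  have "2 * sin x * cos (real (2 * M + 1) * x) = sin (real (2 * Suc M) * x) - sin (real (2 * M) * x)"
  proof -
    have *: "real (2 * Suc M) * x = real (2 * M + 1) * x + x" "real (2 * M) * x = real (2 * M + 1) * x - x"
      by (simp_all add: algebra_simps)
    show ?thesis
      unfolding * by (simp only: sin_add sin_diff) simp
  qed
  with Suc show ?case
    by (simp add: distrib_left)
qed simp

text \<open>For x = d pi / N the telescoped sum has numerator sin (d pi) = 0 if \<open>N\<close> is
  even. If \<open>N\<close> is odd, then \<open>2 * (N div 2) = N - 1\<close> and the numerator is
  sin (d pi - x).\<close>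

lemma sum_cos_odds:
  assumes "0 < d" "d < N"
  shows "(\<Sum>j\<in>odds N. cos (real d * angle N j)) = (if even N then 0 else - ((-1) ^ d / 2))"
proof -
  define x where "x = real d * pi / real N"
  have "0 < x" "x < pi"
    using assms by (simp_all add: x_def field_simps)
  then have pos: "sin x > 0"
    by (rule sin_gt_zero)
  have "(\<Sum>j\<in>odds N. cos (real d * angle N j)) = (\<Sum>m<N div 2. cos (real (2 * m + 1) * x))"
    unfolding sum_odds by (simp only: angle_def x_def times_divide_eq_right times_divide_eq_left mult_ac)
  also have "\<dots> = sin (real (2 * (N div 2)) * x) / (2 * sin x)"
    using sum_cos_odd_multiples[of x "N div 2"] pos by (simp add: field_simps)
  also have "\<dots> = (if even N then 0 else - ((-1) ^ d / 2))"
  proof -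
    have Nx: "real N * x = real d * pi"
      using assms by (simp add: x_def)
    show ?thesis
    proof (cases "even N")
      case True
      then show ?thesis
        using Nx by simp
    next
      case False
      then have "real (2 * (N div 2)) * x = real d * pi - x"
        using Nx assms by (auto elim!: oddE simp: algebra_simps)
      then show ?thesis
        using False pos by (simp add: sin_diff)
    qed
  qed
  finally show ?thesis .
qed

text \<open>The difference of sines is twice sin (theta / 2) times cos ((d + 1/2) theta). The
  cotangent in the weight replaces the first sine by cos (theta / 2), which leaves a sum of two
  cosines.\<close>

lemma weight_wave_diff:
  assumes "j \<in> odds N"
  shows "weight N j * (wave N j (int (Suc d)) - wave N j (int d)) =
    2 / real N * (cos (real d * angle N j) + cos (real (Suc d) * angle N j))"
proof -
  define c s x where "c = cos (angle N j)" and "s = sin (angle N j)" and "x = real d * angle N j"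
  have s: "s > 0" and N: "N > 0"
    using sin_angle_pos[OF assms] assms by (auto simp: s_def odds_def)
  have cs: "c * c = 1 - s * s"
    unfolding c_def s_def using sin_cos_squared_add3[of "angle N j"] by linarith
  have Suc: "real (Suc d) * angle N j = x + angle N j"
    by (simp add: x_def algebra_simps)
  have "(2 + 2 * c) * (sin x * c + cos x * s - sin x) = 2 * s * (cos x + (cos x * c - sin x * s))"
    using cs by algebra
  then have "(2 + 2 * c) / (real N * s) * (sin x * c + cos x * s - sin x) =
      (2 * s * (cos x + (cos x * c - sin x * s))) / (real N * s)"
    by (simp only: times_divide_eq_left)
  also have "\<dots> = 2 / real N * (cos x + (cos x * c - sin x * s))"
    using s N by simp
  finally have "(2 + 2 * c) / (real N * s) * (sin x * c + cos x * s - sin x) =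
      2 / real N * (cos x + (cos x * c - sin x * s))" .
  then show ?thesis
    using Suc
    by (simp add: weight_def wave_def eigval_def sin_add cos_add flip: c_def s_def x_def)
qed

text \<open>The waves expand the square wave that is odd and antiperiodic with antiperiod \<^term>\<open>N\<close>.\<close>

lemma square_wave:
  assumes "0 < d" "d < int N"
  shows "(\<Sum>j\<in>odds N. weight N j * wave N j d) = 1"
proof -
  have diff: "(\<Sum>j\<in>odds N. weight N j * wave N j (int (Suc d))) =
      (\<Sum>j\<in>odds N. weight N j * wave N j (int d)) + (if d = 0 then 1 else 0)"
    if "Suc d < N" for d
  proof -
    have "(\<Sum>j\<in>odds N. weight N j * wave N j (int (Suc d))) -
        (\<Sum>j\<in>odds N. weight N j * wave N j (int d)) =
        (\<Sum>j\<in>odds N. weight N j * (wave N j (int (Suc d)) - wave N j (int d)))"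
      by (simp only: right_diff_distrib sum_subtractf)
    also have "\<dots> = (\<Sum>j\<in>odds N. 2 / real N * (cos (real d * angle N j) + cos (real (Suc d) * angle N j)))"
      by (intro sum.cong refl weight_wave_diff)
    also have "\<dots> = 2 / real N *
        ((\<Sum>j\<in>odds N. cos (real d * angle N j)) + (\<Sum>j\<in>odds N. cos (real (Suc d) * angle N j)))"
      by (simp only: sum_distrib_left sum.distrib distrib_left)
    \<comment> \<open>For d > 0 the two cosine sums are 0 or have opposite signs. For d = 0 the
      first counts the \<open>N div 2\<close> frequencies, and the second adds 1/2 if
      \<open>N\<close> is odd, so together they give N / 2.\<close>
    also have "\<dots> = (if d = 0 then 1 else 0)"
    proof (cases "d = 0")
      case True
      have "(\<Sum>j\<in>odds N. cos (real (Suc d) * angle N j)) = (if even N then 0 else 1 / 2)"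
        using sum_cos_odds[of "Suc d" N] that True by simp
      moreover have "(\<Sum>j\<in>odds N. cos (real d * angle N j)) = real (N div 2)"
        unfolding sum_odds using True by simp
      ultimately show ?thesis
        using True that by (auto elim!: evenE oddE simp: field_simps)
    next
      case False
      then show ?thesis
        using that by (simp only: sum_cos_odds) simp
    qed
    finally show ?thesis
      by simp
  qed
  have "Suc d < N \<Longrightarrow> (\<Sum>j\<in>odds N. weight N j * wave N j (int (Suc d))) = 1" for d
  proof (induction d)
    case 0
    then show ?case
      using diff[of 0] by (simp add: wave_def)
  next
    case (Suc d)
    then show ?case
      using diff[of "Suc d"] by simp
  qed
  from this[of "nat d - 1"] show ?thesis
    using assms by simp
qed

section \<open>Waves and Pfaffians as eigenfunctions\<close>

lemma wave_recurrence: "eigval N j * wave N j d = wave N j (d + 1) + wave N j (d - 1)"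
  by (simp add: wave_def eigval_def distrib_right left_diff_distrib sin_add sin_diff)

lemma wave_0 [simp]: "wave N j 0 = 0"
  by (simp add: wave_def)

text \<open>\<open>N * angle N j\<close> is an odd multiple of pi, and sin (j pi - x) = sin x for
  odd \<open>j\<close>.\<close>

lemma wave_reflect:
  assumes "j \<in> odds N"
  shows "wave N j (int N - d) = wave N j d"
proof -
  have "real N * angle N j = real j * pi"
    using assms by (auto simp: angle_def odds_def)
  moreover have "odd j"
    using assms by (simp add: odds_def)
  ultimately show ?thesis
    by (simp add: wave_def left_diff_distrib sin_diff)
qed

text \<open>The arguments \<open>a\<close>, \<open>b\<close>, \<open>c\<close> are the gaps \<open>y2 - y1\<close>, \<open>y3 - y2\<close>, \<open>y4 - y3\<close>.\<close>

definition pfaff :: "nat \<Rightarrow> nat \<Rightarrow> nat \<Rightarrow> int \<Rightarrow> int \<Rightarrow> int \<Rightarrow> real" where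
  "pfaff N j k a b c =
     wave N j a * wave N k c - wave N j (a + b) * wave N k (b + c) + wave N j (a + b + c) * wave N k b"

text \<open>The four terms on the right move y1, y2, y3, y4 ahead in turn. Each product in the
  Pfaffian contains every particle once, and shifting the argument of a wave by +1 or -1 is moving
  one of its two particles.\<close>

lemma pfaff_recurrence:
  "(eigval N j + eigval N k) * pfaff N j k a b c =
     pfaff N j k (a - 1) b c + pfaff N j k (a + 1) (b - 1) c +
     pfaff N j k a (b + 1) (c - 1) + pfaff N j k a b (c + 1)"
proof -
  have product: "(eigval N j + eigval N k) * (wave N j x * wave N k y) =
      wave N j (x + 1) * wave N k y + wave N j (x - 1) * wave N k y +
      wave N j x * wave N k (y + 1) + wave N j x * wave N k (y - 1)" for x y
  proof -
    have "(eigval N j + eigval N k) * (wave N j x * wave N k y) =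
        (eigval N j * wave N j x) * wave N k y + wave N j x * (eigval N k * wave N k y)"
      by (simp only: distrib_left distrib_right mult_ac)
    then show ?thesis
      by (simp only: wave_recurrence distrib_right distrib_left add.assoc)
  qed
  have args: "a - 1 + b = a + b - 1" "a + 1 + (b - 1) = a + b" "b - 1 + c = b + c - 1"
    "a + (b + 1) = a + b + 1" "b + 1 + (c - 1) = b + c" "b + (c + 1) = b + c + 1"
    "a + b - 1 + c = a + b + c - 1" "a + b + 1 + (c - 1) = a + b + c"
    "a + b + (c + 1) = a + b + c + 1"
    by simp_all
  show ?thesis
    unfolding pfaff_def args distrib_left[of "_ + _"] right_diff_distrib product by linarith
qed

section \<open>The spectral sum: recursion, boundary and initial values\<close>

definition walk_sum :: "nat \<Rightarrow> nat \<Rightarrow> int \<Rightarrow> int \<Rightarrow> int \<Rightarrow> real" where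
  "walk_sum N n a b c = (\<Sum>j\<in>odds N. \<Sum>k\<in>odds N.
     weight N j * weight N k * (eigval N j + eigval N k) ^ n * pfaff N j k a b c)"

lemma walk_sum_Suc:
  "walk_sum N (Suc n) a b c =
     walk_sum N n (a - 1) b c + walk_sum N n (a + 1) (b - 1) c +
     walk_sum N n a (b + 1) (c - 1) + walk_sum N n a b (c + 1)"
proof -
  have "weight N j * weight N k * (eigval N j + eigval N k) ^ Suc n * pfaff N j k a b c =
      weight N j * weight N k * (eigval N j + eigval N k) ^ n *
        ((eigval N j + eigval N k) * pfaff N j k a b c)" for j k
    by (simp only: power_Suc mult_ac)
  then show ?thesis
    unfolding walk_sum_def pfaff_recurrence
    by (simp only: distrib_left sum.distrib)
qed

lemma sum_antisymmetric:
  fixes f :: "'a \<Rightarrow> 'a \<Rightarrow> real"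
  assumes "\<And>j k. j \<in> A \<Longrightarrow> k \<in> A \<Longrightarrow> f k j = - f j k"
  shows "(\<Sum>j\<in>A. \<Sum>k\<in>A. f j k) = 0"
proof -
  have "(\<Sum>j\<in>A. \<Sum>k\<in>A. f j k) = (\<Sum>j\<in>A. \<Sum>k\<in>A. f k j)"
    by (rule sum.swap)
  also have "\<dots> = (\<Sum>j\<in>A. \<Sum>k\<in>A. - f j k)"
    by (intro sum.cong refl assms)
  also have "\<dots> = - (\<Sum>j\<in>A. \<Sum>k\<in>A. f j k)"
    by (simp only: sum_negf)
  finally show ?thesis
    by simp
qed

text \<open>For \<open>b = 0\<close> or \<open>c = 0\<close> the Pfaffian itself vanishes. For
  \<open>a = 0\<close>, and by reflection for \<open>a + b + c = int N\<close>, it is antisymmetric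
  in \<open>j\<close> and \<open>k\<close>, while its coefficient is symmetric.\<close>

lemma walk_sum_boundary:
  assumes "a = 0 \<or> b = 0 \<or> c = 0 \<or> a + b + c = int N"
  shows "walk_sum N n a b c = 0"
  unfolding walk_sum_def
proof (rule sum_antisymmetric)
  fix j k
  assume jk: "j \<in> odds N" "k \<in> odds N"
  have "pfaff N k j a b c = - pfaff N j k a b c"
  proof (cases "a + b + c = int N")
    case True
    have "wave N i (a + b) = wave N i c" "wave N i (b + c) = wave N i a" "wave N i (a + b + c) = 0"
      if "i \<in> odds N" for i
      using wave_reflect[OF that, of c] wave_reflect[OF that, of a] wave_reflect[OF that, of 0]
      by (simp_all flip: True)
    then show ?thesis
      using jk by (simp add: pfaff_def)
  next
    case False
    then show ?thesis
      using assms by (auto simp: pfaff_def)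
  qed
  then show "weight N k * weight N j * (eigval N k + eigval N j) ^ n * pfaff N k j a b c =
      - (weight N j * weight N k * (eigval N j + eigval N k) ^ n * pfaff N j k a b c)"
    by (simp only: add.commute[of "eigval N k" "eigval N j"] mult.commute[of "weight N k" "weight N j"]
        mult_minus_right)
qed

text \<open>Without eigenvalues the double sum factors into square waves. All six differences of
  positions lie strictly between 0 and \<open>N\<close>, so the value is 1 - 1 + 1.\<close>

lemma walk_sum_0:
  assumes "0 < a" "0 < b" "0 < c" "a + b + c < int N"
  shows "walk_sum N 0 a b c = 1"
proof -
  define S where "S d = (\<Sum>j\<in>odds N. weight N j * wave N j d)" for d
  have product: "S x * S y =
      (\<Sum>j\<in>odds N. \<Sum>k\<in>odds N. weight N j * weight N k * (wave N j x * wave N k y))" for x y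
    unfolding S_def sum_product by (simp only: mult_ac)
  have "walk_sum N 0 a b c = S a * S c - S (a + b) * S (b + c) + S (a + b + c) * S b"
    by (simp only: walk_sum_def pfaff_def product sum.distrib sum_subtractf distrib_left
        right_diff_distrib power_0 mult_1_right)
  also have "\<dots> = 1"
    using assms by (simp add: S_def square_wave)
  finally show ?thesis .
qed

section \<open>Lattice points and the recursion for walks\<close>

definition point :: "int \<Rightarrow> int \<Rightarrow> int \<Rightarrow> int \<Rightarrow> real^4" where
  "point x1 x2 x3 x4 = of_int x1 *\<^sub>R std_basis 1 + of_int x2 *\<^sub>R std_basis 2 +
     of_int x3 *\<^sub>R std_basis 3 + of_int x4 *\<^sub>R std_basis 4"

lemma point_nth [simp]:
  "point x1 x2 x3 x4 $ 1 = of_int x1" "point x1 x2 x3 x4 $ 2 = of_int x2"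
  "point x1 x2 x3 x4 $ 3 = of_int x3" "point x1 x2 x3 x4 $ 4 = of_int x4"
  by (simp_all add: point_def axis_def)

lemma pyramid_eq_point:
  "pyramid L = {point (int x1) (int x2) (int x3) (int x4) | x1 x2 x3 x4. x1 + x2 + x3 + x4 = L}"
  by (simp add: pyramid_def point_def)

lemma point_in_pyramid_iff:
  "point x1 x2 x3 x4 \<in> pyramid L \<longleftrightarrow>
     0 \<le> x1 \<and> 0 \<le> x2 \<and> 0 \<le> x3 \<and> 0 \<le> x4 \<and> x1 + x2 + x3 + x4 = int L" (is "?l \<longleftrightarrow> ?r")
proof
  assume ?l
  then obtain y1 y2 y3 y4 where
    eq: "point x1 x2 x3 x4 = point (int y1) (int y2) (int y3) (int y4)" and "y1 + y2 + y3 + y4 = L"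
    by (auto simp: pyramid_eq_point)
  moreover have "x1 = int y1" "x2 = int y2" "x3 = int y3" "x4 = int y4"
    using arg_cong[OF eq, of "\<lambda>v. v $ 1"] arg_cong[OF eq, of "\<lambda>v. v $ 2"]
      arg_cong[OF eq, of "\<lambda>v. v $ 3"] arg_cong[OF eq, of "\<lambda>v. v $ 4"]
    by (simp_all only: point_nth of_int_eq_iff)
  ultimately show ?r
    by auto
next
  assume ?r
  then show ?l
    unfolding pyramid_eq_point
    by (intro CollectI exI[of _ "nat x1"] exI[of _ "nat x2"] exI[of _ "nat x3"] exI[of _ "nat x4"]) auto
qed

lemma point_step:
  "point x1 x2 x3 x4 + (std_basis 1 - std_basis 4) = point (x1 + 1) x2 x3 (x4 - 1)"
  "point x1 x2 x3 x4 + (std_basis 2 - std_basis 1) = point (x1 - 1) (x2 + 1) x3 x4"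
  "point x1 x2 x3 x4 + (std_basis 3 - std_basis 2) = point x1 (x2 - 1) (x3 + 1) x4"
  "point x1 x2 x3 x4 + (std_basis 4 - std_basis 3) = point x1 x2 (x3 - 1) (x4 + 1)"
  by (simp_all add: point_def algebra_simps)

lemma sum_forward_steps:
  "(\<Sum>s\<in>forward_steps. f s) = f (std_basis 1 - std_basis 4) + f (std_basis 2 - std_basis 1) +
     f (std_basis 3 - std_basis 2) + f (std_basis 4 - std_basis 3)"
proof -
  \<comment> \<open>The four steps must be pairwise distinct for the sum over the set to have four
    terms; one coordinate separates each step from the later ones.\<close>
  have "std_basis 1 - std_basis 4 \<notin>
      {std_basis 2 - std_basis 1, std_basis 3 - std_basis 2, std_basis 4 - std_basis 3}"
    by (auto dest!: arg_cong[where f = "\<lambda>v. v $ 1"] simp: axis_def)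
  moreover have "std_basis 2 - std_basis 1 \<notin> {std_basis 3 - std_basis 2, std_basis 4 - std_basis 3}"
    by (auto dest!: arg_cong[where f = "\<lambda>v. v $ 2"] simp: axis_def)
  moreover have "std_basis 3 - std_basis 2 \<notin> {std_basis 4 - std_basis 3}"
    by (auto dest!: arg_cong[where f = "\<lambda>v. v $ 3"] simp: axis_def)
  ultimately show ?thesis
    unfolding forward_steps_def by (simp add: add.assoc)
qed

lemma finite_forward_walks: "finite (forward_walks L z n)"
proof (rule finite_subset)
  show "forward_walks L z n \<subseteq> {ss. set ss \<subseteq> forward_steps \<and> length ss = n}"
    by (auto simp: forward_walks_def)
  show "finite {ss. set ss \<subseteq> forward_steps \<and> length ss = n}"
    by (rule finite_lists_length_eq) (simp add: forward_steps_def)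
qed

lemma forward_walks_outside: "z \<notin> pyramid L \<Longrightarrow> forward_walks L z n = {}"
  by (fastforce simp: forward_walks_def)

lemma forward_walks_0: "z \<in> pyramid L \<Longrightarrow> forward_walks L z 0 = {[]}"
  by (auto simp: forward_walks_def)

lemma forward_walks_Suc:
  assumes "z \<in> pyramid L"
  shows "forward_walks L z (Suc n) = (\<Union>s\<in>forward_steps. (#) s ` forward_walks L (z + s) n)"
proof (intro set_eqI)
  fix ss
  show "ss \<in> forward_walks L z (Suc n) \<longleftrightarrow> ss \<in> (\<Union>s\<in>forward_steps. (#) s ` forward_walks L (z + s) n)"
  proof (cases ss)
    case Nil
    then show ?thesis
      by (auto simp: forward_walks_def)
  next
    case (Cons s ts)
    \<comment> \<open>The case \<open>m = 0\<close> is the assumption on \<open>z\<close>; the other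
      prefixes begin with \<open>s\<close>.\<close>
    have "(\<forall>m\<le>Suc n. z + sum_list (take m ss) \<in> pyramid L) \<longleftrightarrow>
        (\<forall>m\<le>n. z + s + sum_list (take m ts) \<in> pyramid L)"
      using assms by (simp add: All_less_Suc2 Cons add.assoc flip: less_Suc_eq_le)
    then show ?thesis
      by (auto simp: forward_walks_def Cons)
  qed
qed

lemma card_forward_walks_Suc:
  assumes "z \<in> pyramid L"
  shows "card (forward_walks L z (Suc n)) = (\<Sum>s\<in>forward_steps. card (forward_walks L (z + s) n))"
proof -
  have "card (forward_walks L z (Suc n)) = (\<Sum>s\<in>forward_steps. card ((#) s ` forward_walks L (z + s) n))"
    unfolding forward_walks_Suc[OF assms]
    by (rule card_UN_disjoint) (auto simp: forward_steps_def finite_forward_walks)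
  then show ?thesis
    by (simp add: card_image)
qed

text \<open>Coordinates down to -1 are allowed so that a step out of the pyramid stays within the
  induction. At such a point there are no walks, and the spectral sum vanishes: some gap is 0, or
  \<open>x4 = -1\<close> and the gaps add up to \<open>L + 4\<close>. Inside, both sides obey the
  same four-term recursion.\<close>

lemma card_forward_walks:
  assumes "-1 \<le> x1" "-1 \<le> x2" "-1 \<le> x3" "-1 \<le> x4" "x1 + x2 + x3 + x4 = int L"
  shows "real (card (forward_walks L (point x1 x2 x3 x4) n)) =
    walk_sum (L + 4) n (x3 + 1) (x2 + 1) (x1 + 1)"
  using assms
proof (induction n arbitrary: x1 x2 x3 x4)
  case (0 x1 x2 x3 x4)
  show ?case
  proof (cases "0 \<le> x1 \<and> 0 \<le> x2 \<and> 0 \<le> x3 \<and> 0 \<le> x4")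
    case True
    then show ?thesis
      using 0 by (simp add: forward_walks_0 point_in_pyramid_iff walk_sum_0)
  next
    case False
    then have "walk_sum (L + 4) 0 (x3 + 1) (x2 + 1) (x1 + 1) = 0"
      using 0 by (intro walk_sum_boundary) auto
    then show ?thesis
      using False by (auto simp: forward_walks_outside point_in_pyramid_iff)
  qed
next
  case (Suc n x1 x2 x3 x4)
  show ?case
  proof (cases "0 \<le> x1 \<and> 0 \<le> x2 \<and> 0 \<le> x3 \<and> 0 \<le> x4")
    case True
    then have "point x1 x2 x3 x4 \<in> pyramid L"
      using Suc.prems by (simp add: point_in_pyramid_iff)
    then show ?thesis
      using True Suc.prems
      by (simp add: card_forward_walks_Suc sum_forward_steps point_step Suc.IH walk_sum_Suc
          add.commute)
  next
    case False
    then have "walk_sum (L + 4) (Suc n) (x3 + 1) (x2 + 1) (x1 + 1) = 0"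
      using Suc.prems by (intro walk_sum_boundary) auto
    then show ?thesis
      using False by (auto simp: forward_walks_outside point_in_pyramid_iff)
  qed
qed

section \<open>Evaluation at the corner\<close>

lemma weight_pfaff_corner:
  assumes "j \<in> odds N" "k \<in> odds N"
  shows "weight N j * weight N k * (pfaff N j k 1 1 1 + pfaff N k j 1 1 1) =
    (eigval N k - eigval N j)\<^sup>2 * (2 + eigval N j) * (2 + eigval N k) / (real N)\<^sup>2"
proof -
  \<comment> \<open>The Chebyshev recursion makes every wave at the corner a multiple of
    \<open>wave N i 1\<close>, whose sine then cancels against the denominator of the
    weight.\<close>
  have w: "wave N i 2 = eigval N i * wave N i 1" "wave N i 3 = eigval N i * wave N i 2 - wave N i 1" for i
    using wave_recurrence[of N i 1] wave_recurrence[of N i 2] by simp_all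
  have weight: "weight N i * wave N i 1 = (2 + eigval N i) / real N" if "i \<in> odds N" for i
    using sin_angle_pos[OF that] by (simp add: weight_def wave_def)
  have "weight N j * weight N k * (pfaff N j k 1 1 1 + pfaff N k j 1 1 1) =
      (weight N j * wave N j 1) * (weight N k * wave N k 1) * (eigval N k - eigval N j)\<^sup>2"
    by (simp add: pfaff_def w power2_eq_square) algebra
  then show ?thesis
    using assms by (simp add: weight power2_eq_square)
qed

lemma sum_square_eq_sum_less:
  fixes f :: "'a :: linorder \<Rightarrow> 'a \<Rightarrow> 'b :: comm_monoid_add"
  assumes "finite A"
  shows "(\<Sum>j\<in>A. \<Sum>k\<in>A. f j k) =
    (\<Sum>(j, k)\<in>{(j, k). j \<in> A \<and> k \<in> A \<and> j < k}. f j k + f k j) + (\<Sum>j\<in>A. f j j)"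
proof -
  define U where "U = {(j, k). j \<in> A \<and> k \<in> A \<and> j < k}"
  have fin: "finite U"
    by (rule finite_subset[of _ "A \<times> A"]) (auto simp: U_def assms)
  have "(\<Sum>j\<in>A. \<Sum>k\<in>A. f j k) = (\<Sum>(j, k)\<in>A \<times> A. f j k)"
    by (rule sum.cartesian_product)
  also have "A \<times> A = (U \<union> prod.swap ` U) \<union> (\<lambda>j. (j, j)) ` A"
    by (auto simp: U_def image_iff)
  also have "(\<Sum>(j, k)\<in>\<dots>. f j k) =
      (\<Sum>(j, k)\<in>U. f j k) + (\<Sum>(j, k)\<in>prod.swap ` U. f j k) + (\<Sum>(j, k)\<in>(\<lambda>j. (j, j)) ` A. f j k)"
    by (subst sum.union_disjoint, use fin assms in \<open>auto simp: U_def\<close>)+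
  also have "(\<Sum>(j, k)\<in>prod.swap ` U. f j k) = (\<Sum>(j, k)\<in>U. f k j)"
    by (subst sum.reindex) (auto intro!: sum.cong)
  also have "(\<Sum>(j, k)\<in>(\<lambda>j. (j, j)) ` A. f j k) = (\<Sum>j\<in>A. f j j)"
    by (subst sum.reindex) (auto simp: inj_on_def)
  finally show ?thesis
    by (simp add: U_def sum.distrib case_prod_unfold)
qed

lemma num_corner_walks_eq:
  "real (num_corner_walks L n) =
    (\<Sum>(j, k)\<in>{(j, k). j \<in> odds (L + 4) \<and> k \<in> odds (L + 4) \<and> j < k}.
       (eigval (L + 4) k - eigval (L + 4) j)\<^sup>2 * (2 + eigval (L + 4) j) * (2 + eigval (L + 4) k) /
         (real (L + 4))\<^sup>2 * (eigval (L + 4) j + eigval (L + 4) k) ^ n)"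
proof -
  define N where "N = L + 4"
  define f where "f j k = weight N j * weight N k * (eigval N j + eigval N k) ^ n * pfaff N j k 1 1 1" for j k
  have "real (num_corner_walks L n) = real (card (forward_walks L (point 0 0 0 (int L)) n))"
    by (simp add: num_corner_walks_def point_def)
  also have "\<dots> = (\<Sum>j\<in>odds N. \<Sum>k\<in>odds N. f j k)"
    by (simp add: card_forward_walks walk_sum_def N_def f_def)
  also have "\<dots> = (\<Sum>(j, k)\<in>{(j, k). j \<in> odds N \<and> k \<in> odds N \<and> j < k}. f j k + f k j) + (\<Sum>j\<in>odds N. f j j)"
    by (simp add: sum_square_eq_sum_less)
  \<comment> \<open>For equal frequencies the squared difference of eigenvalues in the corner
    formula is 0.\<close>
  also have "(\<Sum>j\<in>odds N. f j j) = 0"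
  proof (rule sum.neutral, rule ballI)
    fix j
    assume "j \<in> odds N"
    from weight_pfaff_corner[OF this this] show "f j j = 0"
      by (auto simp: f_def)
  qed
  also have "(\<Sum>(j, k)\<in>{(j, k). j \<in> odds N \<and> k \<in> odds N \<and> j < k}. f j k + f k j) =
    (\<Sum>(j, k)\<in>{(j, k). j \<in> odds N \<and> k \<in> odds N \<and> j < k}.
      (eigval N k - eigval N j)\<^sup>2 * (2 + eigval N j) * (2 + eigval N k) / (real N)\<^sup>2 *
        (eigval N j + eigval N k) ^ n)"
  proof (intro sum.cong refl, clarify)
    fix j k
    assume jk: "j \<in> odds N" "k \<in> odds N"
    have "f j k + f k j = weight N j * weight N k * (pfaff N j k 1 1 1 + pfaff N k j 1 1 1) *
        (eigval N j + eigval N k) ^ n"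
      by (simp add: f_def add.commute[of "eigval N k"] algebra_simps)
    then show "f j k + f k j =
        (eigval N k - eigval N j)\<^sup>2 * (2 + eigval N j) * (2 + eigval N k) / (real N)\<^sup>2 *
        (eigval N j + eigval N k) ^ n"
      by (simp only: weight_pfaff_corner[OF jk])
  qed
  finally show ?thesis
    by (simp add: N_def)
qed

section \<open>Passage to the generating function\<close>

lemma fps_nth_const_divide:
  fixes c r :: "'a :: field"
  shows "fps_nth (fps_const c / (1 - fps_const r * fps_X)) n = c * r ^ n"
proof -
  define D where "D = 1 - fps_const r * fps_X"
  \<comment> \<open>The geometric series is an inverse of \<open>D\<close>, so the quotient becomes
    a product.\<close>
  have "fps_nth (Abs_fps (\<lambda>n. r ^ n) * D) n = fps_nth 1 n" for n
    by (cases n) (simp_all add: D_def right_diff_distrib mult.left_commute[of _ "fps_const r"])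
  then have "Abs_fps (\<lambda>n. r ^ n) * D = 1"
    by (simp add: fps_eq_iff)
  moreover have "D \<noteq> 0"
    using calculation by auto
  ultimately have "fps_const c / D = fps_const c * Abs_fps (\<lambda>n. r ^ n)"
    by (metis mult.assoc mult.right_neutral nonzero_mult_div_cancel_right)
  then show ?thesis
    by (simp add: D_def)
qed

theorem corollary39:
  fixes L :: nat and \<alpha> :: complex
  assumes "\<alpha> = exp (\<i> * of_real pi / of_nat (L + 4))"
  shows "walk_gf L =
    fps_const (1 / of_nat (L + 4) ^ 2) *
    (\<Sum>(j, k) \<in> {(j :: nat, k :: nat). 1 \<le> j \<and> j < k \<and> k \<le> L + 3 \<and> odd j \<and> odd k}.
       fps_const
         ((\<alpha> powi int k + \<alpha> powi (- int k) - \<alpha> powi int j - \<alpha> powi (- int j)) ^ 2 *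
          (2 + \<alpha> powi int j + \<alpha> powi (- int j)) *
          (2 + \<alpha> powi int k + \<alpha> powi (- int k))) /
       (1 - fps_const (\<alpha> powi int j + \<alpha> powi (- int j) + \<alpha> powi int k + \<alpha> powi (- int k)) * fps_X))"
proof -
  define N where "N = L + 4"
  define e where "e i = complex_of_real (eigval N i)" for i
  have "\<alpha> = cis (pi / real N)"
    by (simp add: assms cis_conv_exp N_def)
  then have pow: "\<alpha> powi i = cis (of_int i * (pi / real N))" for i
    by (simp add: cis_power_int)
  \<comment> \<open>The two powers are complex conjugates on the unit circle, so their sum is twice
    a cosine.\<close>
  have e: "e i = \<alpha> powi int i + \<alpha> powi (- int i)" for i
    unfolding pow by (simp add: e_def eigval_def angle_def complex_eq_iff)
  have set: "{(j :: nat, k :: nat). 1 \<le> j \<and> j < k \<and> k \<le> L + 3 \<and> odd j \<and> odd k} =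
      {(j, k). j \<in> odds N \<and> k \<in> odds N \<and> j < k}"
    by (auto simp: odds_def N_def Suc_le_eq odd_pos)
  have e1: "\<alpha> powi int k + \<alpha> powi (- int k) - \<alpha> powi int j - \<alpha> powi (- int j) = e k - e j"
    "2 + \<alpha> powi int j + \<alpha> powi (- int j) = 2 + e j"
    "\<alpha> powi int j + \<alpha> powi (- int j) + \<alpha> powi int k + \<alpha> powi (- int k) = e j + e k" for j k
    by (simp_all add: e)
  show ?thesis
    unfolding set e1
  proof (rule fps_ext)
    fix n
    have "fps_nth (walk_gf L) n = complex_of_real (real (num_corner_walks L n))"
      by (simp add: walk_gf_def)
    also have "\<dots> = (\<Sum>(j, k)\<in>{(j, k). j \<in> odds N \<and> k \<in> odds N \<and> j < k}.
        (1 / of_nat (L + 4) ^ 2) * ((e k - e j)\<^sup>2 * (2 + e j) * (2 + e k) * (e j + e k) ^ n))"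
      unfolding num_corner_walks_eq of_real_sum
      by (intro sum.cong) (auto simp: e_def N_def)
    also have "\<dots> = fps_nth (fps_const (1 / of_nat (L + 4) ^ 2) *
        (\<Sum>(j, k)\<in>{(j, k). j \<in> odds N \<and> k \<in> odds N \<and> j < k}.
          fps_const ((e k - e j)\<^sup>2 * (2 + e j) * (2 + e k)) / (1 - fps_const (e j + e k) * fps_X))) n"
      by (simp only: fps_mult_left_const_nth fps_sum_nth case_prod_unfold fps_nth_const_divide
          sum_distrib_left)
    finally show "fps_nth (walk_gf L) n = \<dots>" .
  qed
qed

end
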